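(* Let $\mu\in\mathbb{R}$, $\sigma>0$ and $t\in\mathbb{R}$, and let $\mathcal{P}_{(\mu,\sigma)}$ be the set of probability distributions on $\mathbb{R}$ with mean $\mu$ and variance $\sigma^2$. For a real-valued random variable $X$ with distribution $\mathbb{P}\in\mathcal{P}_{(\mu,\sigma)}$, it holds that $$\sup_{\mathbb{P}\in\mathcal{P}_{(\mu,\sigma)}}\mathbb{E}_{\mathbb{P}}[X\mid X\ge t]=\begin{cases}\mu+\dfrac{\sigma^2}{\mu-t},&\text{for }t<\mu,\\[2mm]\infty,&\text{for }t\ge\mu.\end{cases}$$
   Context: The conditional expectation is $\mathbb{E}_{\mathbb{P}}[X\mid X\ge t]=\mathbb{E}_{\mathbb{P}}[X\mathbf{1}_{\{X\ge t\}}]/\mathbb{P}(X\ge t)$, and the supremum is taken over those $\mathbb{P}$ in the set for which $\mathbb{P}(X\ge t)>0$. The supremum need not be attained. *)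

theory Defs
  imports "HOL-Probability.Probability"
begin

text \<open>
  Integrability is required explicitly because the Bochner integral of a non-integrable
  function is 0 by convention. A distribution \<open>P\<close> is the law of the random variable
  \<open>\<lambda>x. x\<close> on it.
\<close>

definition mean_variance_dists :: "real \<Rightarrow> real \<Rightarrow> real measure set" where
  "mean_variance_dists \<mu> \<sigma> =
     {P. real_distribution P \<and> integrable P (\<lambda>x. x) \<and> integrable P (\<lambda>x. x\<^sup>2) \<and>
         prob_space.expectation P (\<lambda>x. x) = \<mu> \<and> prob_space.variance P (\<lambda>x. x) = \<sigma>\<^sup>2}"

text \<open>Only meaningful when the conditioning event has positive probability.\<close>

definition event_cond_exp :: "'a measure \<Rightarrow> ('a \<Rightarrow> real) \<Rightarrow> 'a set \<Rightarrow> real" where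
  "event_cond_exp M X A = (\<integral>\<omega>. X \<omega> * indicator A \<omega> \<partial>M) / measure M A"

end

theory Submission
  imports Defs
begin

text \<open>
  Write \<open>s = \<mu> - t\<close>. For \<open>s > 0\<close> the upper bound comes from linear programming duality: the function
  \<open>(x - \<mu> - \<sigma>\<^sup>2 / s) * indicator {t..} x\<close> lies below the quadratic
  \<open>c * (x - t) * (x - \<mu> - \<sigma>\<^sup>2 / s)\<close> with \<open>c = s / (s\<^sup>2 + \<sigma>\<^sup>2)\<close>, and the expectation of the
  quadratic is determined by mean and variance: it is \<open>0\<close>. Taking expectations bounds the
  conditional mean by \<open>\<mu> + \<sigma>\<^sup>2 / s\<close> (\<open>event_cond_exp_atLeast_le\<close>).

  Tightness suggests a law on the zeros \<open>t\<close> and \<open>\<mu> + \<sigma>\<^sup>2 / s\<close> of the quadratic whose atom at \<open>t\<close> is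
  not counted in the conditioning event. That atom does belong to the event, so one
  moves it slightly to the left. For every \<open>r > 0\<close> there is a law in the class with atoms
  \<open>\<mu> - r\<close> and \<open>\<mu> + \<sigma>\<^sup>2 / r\<close>; as soon as \<open>t\<close> separates the atoms, its conditional mean is the upper
  atom (\<open>two_point_law_attains\<close>). Letting \<open>r\<close> decrease to \<open>max 0 s\<close> gives \<open>\<mu> + \<sigma>\<^sup>2 / s\<close> when \<open>s > 0\<close>.
  When \<open>s \<le> 0\<close> the limit is \<open>0\<close>, so the upper atom, and with it the supremum, is unbounded.
\<close>

text \<open>
  The quadratic of the duality argument. It vanishes at \<open>t\<close>, is nonnegative to the left of \<open>t\<close>, and
  is tangent at \<open>\<mu> + \<sigma>\<^sup>2 / (\<mu> - t)\<close> to the line that it has to dominate, so that the difference on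
  \<open>{t..}\<close> is a multiple of a square.
\<close>

lemma truncated_line_le_quadratic:
  fixes \<mu> \<sigma> t x :: real
  assumes "t < \<mu>"
  defines "u \<equiv> \<mu> + \<sigma>\<^sup>2 / (\<mu> - t)"
  defines "c \<equiv> (\<mu> - t) / ((\<mu> - t)\<^sup>2 + \<sigma>\<^sup>2)"
  shows "(x - u) * indicator {t..} x \<le> c * ((x - t) * (x - u))"
proof -
  have c: "c > 0"
    unfolding c_def using assms(1) by (simp add: add_pos_nonneg)
  have "(\<mu> - t)\<^sup>2 + \<sigma>\<^sup>2 > 0"
    using assms(1) by (simp add: add_pos_nonneg)
  moreover have "u - t = ((\<mu> - t)\<^sup>2 + \<sigma>\<^sup>2) / (\<mu> - t)"
    unfolding u_def using assms(1) by (simp add: add_divide_distrib power2_eq_square)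
  ultimately have cu: "c * (u - t) = 1"
    unfolding c_def using assms(1) by simp
  have "u > t"
    unfolding u_def by (rule less_le_trans[OF assms(1)]) (use assms(1) in simp)
  show ?thesis
  proof (cases "t \<le> x")
    case True
    have "c * ((x - t) * (x - u)) - (x - u)
        = c * (x - u)\<^sup>2 + (c * (u - t) - 1) * (x - u)"
      by (simp add: algebra_simps power2_eq_square)
    also have "\<dots> \<ge> 0"
      using c cu by simp
    finally show ?thesis using True by simp
  next
    case False
    then have "(x - t) * (x - u) \<ge> 0"
      using \<open>u > t\<close> by (intro mult_nonpos_nonpos) auto
    then show ?thesis using False c by simp
  qed
qed

lemma event_cond_exp_atLeast_le:
  fixes \<mu> \<sigma> t :: real
  assumes P: "P \<in> mean_variance_dists \<mu> \<sigma>"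
    and pos: "measure P {x. x \<ge> t} > 0"
    and "t < \<mu>"
  shows "event_cond_exp P (\<lambda>x. x) {x. x \<ge> t} \<le> \<mu> + \<sigma>\<^sup>2 / (\<mu> - t)"
proof -
  define u where "u = \<mu> + \<sigma>\<^sup>2 / (\<mu> - t)"
  define c where "c = (\<mu> - t) / ((\<mu> - t)\<^sup>2 + \<sigma>\<^sup>2)"
  interpret real_distribution P
    using P by (simp add: mean_variance_dists_def)
  have int1[simp]: "integrable P (\<lambda>x. x)" and int2[simp]: "integrable P (\<lambda>x. x\<^sup>2)"
    and mean: "expectation (\<lambda>x. x) = \<mu>"
    and var: "variance (\<lambda>x. x) = \<sigma>\<^sup>2"
    using P by (auto simp: mean_variance_dists_def)
  have second_moment: "expectation (\<lambda>x. x\<^sup>2) = \<sigma>\<^sup>2 + \<mu>\<^sup>2"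
    using variance_eq[OF int1 int2] var mean by simp
  have half_line: "{x. x \<ge> t} = {t..}" by auto
  have int_trunc: "integrable P (\<lambda>x. x * indicator {t..} x)"
    using integrable_mult_indicator[OF _ int1, of "{t..}"] by (simp add: mult.commute)
  have quad: "(x - t) * (x - u) = x\<^sup>2 - (t + u) * x + t * u" for x
    by (simp add: algebra_simps power2_eq_square)
  have quad_zero: "expectation (\<lambda>x. c * ((x - t) * (x - u))) = 0"
  proof -
    have "expectation (\<lambda>x. (x - t) * (x - u)) = \<sigma>\<^sup>2 + \<mu>\<^sup>2 - (t + u) * \<mu> + t * u"
      unfolding quad using prob_space by (simp add: mean second_moment)
    also have "\<dots> = \<sigma>\<^sup>2 - (\<mu> - t) * (u - \<mu>)"
      by (simp add: algebra_simps power2_eq_square)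
    also have "\<dots> = 0"
      using \<open>t < \<mu>\<close> by (simp add: u_def)
    finally show ?thesis by simp
  qed
  have "expectation (\<lambda>x. (x - u) * indicator {t..} x)
      = expectation (\<lambda>x. x * indicator {t..} x) - u * prob {t..}"
    unfolding left_diff_distrib using int_trunc
    by (subst Bochner_Integration.integral_diff) (simp_all add: less_top[symmetric])
  moreover have "expectation (\<lambda>x. (x - u) * indicator {t..} x)
      \<le> expectation (\<lambda>x. c * ((x - t) * (x - u)))"
  proof (rule integral_mono)
    show "integrable P (\<lambda>x. (x - u) * indicator {t..} x)"
      unfolding left_diff_distrib using int_trunc
      by (rule Bochner_Integration.integrable_diff) (simp add: less_top[symmetric])
    show "integrable P (\<lambda>x. c * ((x - t) * (x - u)))"
      unfolding quad by simp
    show "(x - u) * indicator {t..} x \<le> c * ((x - t) * (x - u))" for x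
      unfolding u_def c_def by (rule truncated_line_le_quadratic[OF \<open>t < \<mu>\<close>])
  qed
  ultimately have "expectation (\<lambda>x. x * indicator {t..} x) \<le> u * prob {t..}"
    using quad_zero by linarith
  then show ?thesis
    using pos by (simp add: event_cond_exp_def half_line u_def pos_divide_le_eq)
qed

text \<open>
  The weight \<open>r\<^sup>2 / (r\<^sup>2 + \<sigma>\<^sup>2)\<close> of the upper atom balances the two deviations \<open>\<sigma>\<^sup>2 / r\<close> and \<open>- r\<close>;
  their product \<open>- \<sigma>\<^sup>2\<close> then makes the variance \<open>\<sigma>\<^sup>2\<close>, for whatever \<open>r\<close>.
\<close>

lemma two_point_law_attains:
  fixes \<mu> \<sigma> t r :: real
  assumes "\<sigma> > 0" "r > 0" and lower: "\<mu> - r < t" and upper: "t \<le> \<mu> + \<sigma>\<^sup>2 / r"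
  obtains P where "P \<in> mean_variance_dists \<mu> \<sigma>" "measure P {x. x \<ge> t} > 0"
    "event_cond_exp P (\<lambda>x. x) {x. x \<ge> t} = \<mu> + \<sigma>\<^sup>2 / r"
proof -
  define p where "p = r\<^sup>2 / (r\<^sup>2 + \<sigma>\<^sup>2)"
  define X where "X = (\<lambda>b. if b then \<mu> + \<sigma>\<^sup>2 / r else \<mu> - r)"
  define B where "B = measure_pmf (bernoulli_pmf p)"
  define P where "P = distr B borel X"
  have denom: "r\<^sup>2 + \<sigma>\<^sup>2 > 0"
    using assms by (simp add: add_pos_pos)
  have p: "0 < p" "p \<le> 1" "1 - p = \<sigma>\<^sup>2 / (r\<^sup>2 + \<sigma>\<^sup>2)"
    using assms denom by (simp_all add: p_def field_simps)
  have X[measurable]: "X \<in> borel_measurable B"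
    by (simp add: B_def)
  have integral: "(\<integral>x. f x \<partial>P) = f (\<mu> + \<sigma>\<^sup>2 / r) * p + f (\<mu> - r) * (1 - p)"
    if [measurable]: "f \<in> borel_measurable borel" for f :: "real \<Rightarrow> real"
    using p unfolding P_def by (subst integral_distr) (simp_all add: B_def X_def)
  have integrable: "integrable P f"
    if [measurable]: "f \<in> borel_measurable borel" for f :: "real \<Rightarrow> real"
    unfolding P_def
    by (subst integrable_distr_eq) (auto simp: B_def intro!: integrable_measure_pmf_finite)
  have "prob_space B"
    unfolding B_def by (rule prob_space_measure_pmf)
  then have "real_distribution P"
    unfolding P_def by (intro prob_space.real_distribution_distr) simp_all
  moreover have mean: "(\<integral>x. x \<partial>P) = \<mu>"
  proof -
    have "(\<integral>x. x \<partial>P) = \<mu> + (\<sigma>\<^sup>2 / r * p - r * (1 - p))"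
      by (simp add: integral algebra_simps)
    also have "\<sigma>\<^sup>2 / r * p = r * (1 - p)"
      unfolding p(3) unfolding p_def using \<open>r > 0\<close> by (simp add: power2_eq_square)
    finally show ?thesis by simp
  qed
  moreover have "(\<integral>x. (x - \<mu>)\<^sup>2 \<partial>P) = \<sigma>\<^sup>2"
  proof -
    have "(\<integral>x. (x - \<mu>)\<^sup>2 \<partial>P) = (\<sigma>\<^sup>2 / r)\<^sup>2 * p + r\<^sup>2 * (1 - p)"
      by (simp add: integral)
    also have "(\<sigma>\<^sup>2 / r)\<^sup>2 * p = \<sigma>\<^sup>2 * (1 - p)"
      unfolding p(3) unfolding p_def using \<open>r > 0\<close> by (simp add: power2_eq_square)
    also have "\<sigma>\<^sup>2 * (1 - p) + r\<^sup>2 * (1 - p) = (r\<^sup>2 + \<sigma>\<^sup>2) * (1 - p)"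
      by (simp add: algebra_simps)
    also have "\<dots> = \<sigma>\<^sup>2"
      unfolding p(3) using denom by simp
    finally show ?thesis .
  qed
  ultimately have "P \<in> mean_variance_dists \<mu> \<sigma>"
    by (simp add: mean_variance_dists_def integrable)
  moreover have half_line: "{x. x \<ge> t} = {t..}" by auto
  interpret real_distribution P by fact
  have prob: "measure P {x. x \<ge> t} = p"
  proof -
    have "measure P {t..} = (\<integral>x. indicator {t..} x \<partial>P)"
      by simp
    also have "\<dots> = p"
      using lower upper by (subst integral) (simp_all add: indicator_def)
    finally show ?thesis by (simp add: half_line)
  qed
  have "(\<integral>x. x * indicator {t..} x \<partial>P) = (\<mu> + \<sigma>\<^sup>2 / r) * p"
    using lower upper by (subst integral) (simp_all add: indicator_def)
  then have "event_cond_exp P (\<lambda>x. x) {x. x \<ge> t} = \<mu> + \<sigma>\<^sup>2 / r"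
    using p prob by (simp add: event_cond_exp_def half_line)
  ultimately show thesis
    using that p prob by simp
qed

theorem proposition1:
  fixes \<mu> \<sigma> t :: real
  assumes "\<sigma> > 0"
  shows "(SUP P \<in> {P \<in> mean_variance_dists \<mu> \<sigma>. measure P {x. x \<ge> t} > 0}.
            ereal (event_cond_exp P (\<lambda>x. x) {x. x \<ge> t})) =
         (if t < \<mu> then ereal (\<mu> + \<sigma>\<^sup>2 / (\<mu> - t)) else \<infinity>)"
    (is "?S = _")
proof -
  have attained: "ereal (\<mu> + \<sigma>\<^sup>2 / r) \<le> ?S"
    if "r > 0" "\<mu> - t < r" "t \<le> \<mu> + \<sigma>\<^sup>2 / r" for r
  proof -
    have "\<mu> - r < t" using that by simp
    from two_point_law_attains[OF assms that(1) this that(3)] obtain P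
      where "P \<in> mean_variance_dists \<mu> \<sigma>" "measure P {x. x \<ge> t} > 0"
        and eq: "event_cond_exp P (\<lambda>x. x) {x. x \<ge> t} = \<mu> + \<sigma>\<^sup>2 / r" by blast
    then show ?thesis
      unfolding eq[symmetric] by (intro SUP_upper) simp
  qed
  show ?thesis
  proof (cases "t < \<mu>")
    case True
    have "?S \<le> ereal (\<mu> + \<sigma>\<^sup>2 / (\<mu> - t))"
      using event_cond_exp_atLeast_le[OF _ _ True] by (intro SUP_least) simp
    moreover have "ereal (\<mu> + \<sigma>\<^sup>2 / (\<mu> - t)) \<le> ?S"
    proof (rule tendsto_upperbound)
      show "((\<lambda>r. ereal (\<mu> + \<sigma>\<^sup>2 / r)) \<longlongrightarrow> ereal (\<mu> + \<sigma>\<^sup>2 / (\<mu> - t))) (at_right (\<mu> - t))"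
        using True by (intro tendsto_intros) simp_all
      have "ereal (\<mu> + \<sigma>\<^sup>2 / r) \<le> ?S" if "r > \<mu> - t" for r
      proof (rule attained)
        show "r > 0" using that True by simp
        then have "\<sigma>\<^sup>2 / r \<ge> 0" by simp
        then show "t \<le> \<mu> + \<sigma>\<^sup>2 / r" using True by linarith
      qed (rule that)
      then show "\<forall>\<^sub>F r in at_right (\<mu> - t). ereal (\<mu> + \<sigma>\<^sup>2 / r) \<le> ?S"
        by (simp add: eventually_at_filter)
    qed simp
    ultimately show ?thesis using True by simp
  next
    case False
    have "ereal y \<le> ?S" for y
    proof -
      \<comment> \<open>The two-point law whose upper atom is \<open>m\<close>, chosen beyond \<open>t\<close>, \<open>y\<close> and \<open>\<mu>\<close>.\<close>
      define m where "m = max t y + 1"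
      have m: "m > \<mu>" "t \<le> m" "y \<le> m"
        using False by (auto simp: m_def)
      have atom: "\<mu> + \<sigma>\<^sup>2 / (\<sigma>\<^sup>2 / (m - \<mu>)) = m"
        using assms m by simp
      have "\<sigma>\<^sup>2 / (m - \<mu>) > 0"
        using assms m by simp
      then have "ereal m \<le> ?S"
        using attained[of "\<sigma>\<^sup>2 / (m - \<mu>)"] m False unfolding atom by linarith
      then show ?thesis
        using m(3) by (meson ereal_less_eq(3) order_trans)
    qed
    then have "?S = \<infinity>"
      by (rule ereal_top)
    then show ?thesis using False by simp
  qed
qed

end
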